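(* Let $x>0$, $x\neq 1$, and let $n\ge 3$ be odd. Let $\mathbf{LPC}(x,n)$ be the $n\times n$ layer-cake pairwise comparisons matrix. Then its Perron root is $$\lambda_{\max}=1+\frac{n-1}{2}\left(x+\frac1x\right),$$ with corresponding eigenvector $(1,1,\dots,1)^T$, and consequently $$CI\bigl(\mathbf{LPC}(x,n)\bigr)=\frac{(x-1)^2}{2x}.$$
   Context: The layer-cake matrix $\mathbf{LPC}(x,n)=(a_{ij})_{i,j=1}^n$ is defined by $a_{ii}=1$; for $i<j$, $a_{ij}=x$ if $j-i$ is odd and $a_{ij}=1/x$ if $j-i$ is even; and $a_{ji}=1/a_{ij}$ for $i<j$. The Perron root $\lambda_{\max}$ of a square matrix with positive entries is its spectral radius (which is an eigenvalue). For an $n\times n$ positive reciprocal matrix $\mathbf{A}$ (that is, $a_{ij}>0$ and $a_{ij}=1/a_{ji}$ for all $i,j$), the consistency index is $CI(\mathbf{A})=\dfrac{\lambda_{\max}(\mathbf{A})-n}{n-1}$. *)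

theory Defs
  imports "Jordan_Normal_Form.Spectral_Radius"
begin

(* Row and column indices run over 0..<n instead of 1..n; only differences of indices
   matter, so the entries are unaffected. *)

definition lpc_upper :: "real \<Rightarrow> nat \<Rightarrow> nat \<Rightarrow> real" where
  "lpc_upper x i j = (if odd (j - i) then x else 1 / x)"

definition LPC :: "real \<Rightarrow> nat \<Rightarrow> real mat" where
  "LPC x n = mat n n (\<lambda>(i, j).
     if i = j then 1
     else if i < j then lpc_upper x i j
     else 1 / lpc_upper x j i)"

(* The spectrum is taken over the complex numbers. *)
definition perron_root :: "real mat \<Rightarrow> real" where
  "perron_root A = spectral_radius (map_mat complex_of_real A)"

definition positive_reciprocal :: "real mat \<Rightarrow> bool" where
  "positive_reciprocal A \<longleftrightarrow> square_mat A \<and>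
     (\<forall>i < dim_row A. \<forall>j < dim_row A. A $$ (i, j) > 0 \<and> A $$ (i, j) = 1 / A $$ (j, i))"

(* Meaningful for positive reciprocal matrices of size at least 2. *)
definition consistency_index :: "real mat \<Rightarrow> real" where
  "consistency_index A = (perron_root A - real (dim_row A)) / (real (dim_row A) - 1)"

lemma positive_reciprocal_LPC:
  assumes "x > 0"
  shows "positive_reciprocal (LPC x n)"
  using assms by (auto simp: positive_reciprocal_def LPC_def lpc_upper_def)

end

theory Submission
  imports Defs
begin

text \<open>
  For odd \<open>n\<close> the layer-cake matrix is circulant. Below the diagonal, passing from
  \<open>i - j\<close> to the wrapped difference \<open>n - (i - j)\<close> changes the parity, which is exactly
  what taking the reciprocal does to the entries. So the entry at \<open>(i, j)\<close> depends only on
  \<open>j - i\<close> modulo \<open>n\<close>, and every row is a permutation of \<open>1, x, 1/x, x, 1/x, \<dots>\<close>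
  (\<open>LPC_circulant\<close>). All row sums therefore equal \<open>1 + (n - 1)/2 \<cdot> (x + 1/x)\<close>.

  A nonnegative matrix whose row sums all equal \<open>r\<close> has Perron root \<open>r\<close>
  (\<open>perron_root_constant_row_sum\<close>): the all-ones vector has eigenvalue \<open>r\<close>, and
  comparing the eigenvalue equation at an entry of largest modulus bounds every complex
  eigenvalue by \<open>r\<close>. The consistency index is then a computation.
\<close>

lemma mult_ones_constant_row_sum:
  fixes A :: "'a :: comm_ring_1 mat"
  assumes A: "A \<in> carrier_mat n n"
    and rows: "\<And>i. i < n \<Longrightarrow> (\<Sum>j<n. A $$ (i, j)) = r"
  shows "A *\<^sub>v vec n (\<lambda>_. 1) = r \<cdot>\<^sub>v vec n (\<lambda>_. 1)"
  using assms by (intro eq_vecI) (auto simp: scalar_prod_def atLeast0LessThan)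

lemma eigenvector_ones_constant_row_sum:
  fixes A :: "'a :: comm_ring_1 mat"
  assumes A: "A \<in> carrier_mat n n" and "n > 0"
    and rows: "\<And>i. i < n \<Longrightarrow> (\<Sum>j<n. A $$ (i, j)) = r"
  shows "eigenvector A (vec n (\<lambda>_. 1)) r"
proof -
  have "vec n (\<lambda>_. 1) \<noteq> (0\<^sub>v n :: 'a vec)"
  proof
    assume "vec n (\<lambda>_. 1) = (0\<^sub>v n :: 'a vec)"
    then have "vec n (\<lambda>_. 1) $ 0 = (0\<^sub>v n :: 'a vec) $ 0"
      by simp
    then show False using \<open>n > 0\<close> by simp
  qed
  then show ?thesis
    using A mult_ones_constant_row_sum[OF A rows] by (auto simp: eigenvector_def)
qed

text \<open>At an index \<open>i\<close> where \<open>\<bar>v i\<bar>\<close> is largest, the triangle inequality gives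
  \<open>\<bar>k\<bar> \<bar>v i\<bar> \<le> (\<Sum>j. \<bar>A i j\<bar>) \<bar>v i\<bar>\<close>, and \<open>\<bar>v i\<bar>\<close> can be cancelled because \<open>v\<close> is
  not zero.\<close>

lemma norm_eigenvalue_le_row_sum:
  fixes A :: "complex mat"
  assumes A: "A \<in> carrier_mat n n"
    and rows: "\<And>i. i < n \<Longrightarrow> (\<Sum>j<n. cmod (A $$ (i, j))) \<le> r"
    and "eigenvalue A k"
  shows "cmod k \<le> r"
proof -
  obtain v where v: "v \<in> carrier_vec n" "v \<noteq> 0\<^sub>v n" and eq: "A *\<^sub>v v = k \<cdot>\<^sub>v v"
    using A \<open>eigenvalue A k\<close> by (auto simp: eigenvalue_def eigenvector_def)
  obtain l where l: "l < n" "v $ l \<noteq> 0"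
    using v by (metis carrier_vecD eq_vecI index_zero_vec)
  define M where "M = Max ((\<lambda>i. cmod (v $ i)) ` {..<n})"
  have M: "cmod (v $ j) \<le> M" if "j < n" for j
    unfolding M_def using that by (intro Max_ge) auto
  have "M \<in> (\<lambda>i. cmod (v $ i)) ` {..<n}"
    unfolding M_def using l by (intro Max_in) auto
  then obtain i where i: "i < n" "M = cmod (v $ i)"
    by auto
  have "M > 0"
    using M[of l] l by (meson less_le_trans zero_less_norm_iff)
  have "(A *\<^sub>v v) $ i = (k \<cdot>\<^sub>v v) $ i"
    by (simp only: eq)
  then have "k * v $ i = (\<Sum>j<n. A $$ (i, j) * v $ j)"
    using A v i by (auto simp: scalar_prod_def atLeast0LessThan)
  then have "cmod k * M = cmod (\<Sum>j<n. A $$ (i, j) * v $ j)"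
    using i by (metis norm_mult)
  also have "\<dots> \<le> (\<Sum>j<n. cmod (A $$ (i, j)) * cmod (v $ j))"
    by (rule order_trans[OF norm_sum]) (simp add: norm_mult)
  also have "\<dots> \<le> (\<Sum>j<n. cmod (A $$ (i, j)) * M)"
    by (intro sum_mono mult_left_mono) (auto intro: M)
  also have "\<dots> \<le> r * M"
    using rows[OF i(1)] \<open>M > 0\<close> by (simp flip: sum_distrib_right)
  finally show ?thesis
    using \<open>M > 0\<close> by simp
qed

lemma perron_root_constant_row_sum:
  assumes A: "A \<in> carrier_mat n n" and "n > 0"
    and nonneg: "\<And>i j. i < n \<Longrightarrow> j < n \<Longrightarrow> A $$ (i, j) \<ge> 0"
    and rows: "\<And>i. i < n \<Longrightarrow> (\<Sum>j<n. A $$ (i, j)) = r"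
  shows "perron_root A = r"
proof -
  let ?C = "map_mat complex_of_real A"
  have C: "?C \<in> carrier_mat n n"
    using A by simp
  have "r \<ge> 0"
    using rows[OF \<open>n > 0\<close>] nonneg \<open>n > 0\<close> by (metis lessThan_iff sum_nonneg)
  have "(\<Sum>j<n. ?C $$ (i, j)) = of_real r" if "i < n" for i
    using A that rows[OF that] by (simp flip: of_real_sum)
  then have "eigenvalue ?C (of_real r)"
    using eigenvector_ones_constant_row_sum[OF C \<open>n > 0\<close>] unfolding eigenvalue_def by blast
  then have "cmod (of_real r) \<le> spectral_radius ?C"
    by (intro spectral_radius_mem_max(2)[OF C \<open>n > 0\<close>]) (unfold spectrum_def, blast)
  moreover have "(\<Sum>j<n. cmod (?C $$ (i, j))) \<le> r" if "i < n" for i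
    using A that rows[OF that] nonneg by simp
  then have "cmod k \<le> r" if "eigenvalue ?C k" for k
    using norm_eigenvalue_le_row_sum[OF C _ that] by blast
  then have "spectral_radius ?C \<le> r"
    using spectral_radius_mem_max(1)[OF C \<open>n > 0\<close>] by (auto simp: spectrum_def)
  ultimately show ?thesis
    using \<open>r \<ge> 0\<close> by (simp add: perron_root_def)
qed

text \<open>The first row of the matrix, which serves as the generating sequence of the circulant.\<close>

definition lpc_row :: "real \<Rightarrow> nat \<Rightarrow> real" where
  "lpc_row x d = (if d = 0 then 1 else if odd d then x else 1 / x)"

text \<open>The second branch is where \<open>odd n\<close> enters: \<open>i - j\<close> and \<open>j + n - i\<close> have opposite parity.\<close>

lemma LPC_circulant:
  assumes "odd n" "i < n" "j < n"
  shows "LPC x n $$ (i, j) = lpc_row x (if i \<le> j then j - i else j + n - i)"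
  using assms by (auto simp: LPC_def lpc_upper_def lpc_row_def)

lemma sum_lpc_row:
  "(\<Sum>d < Suc (2 * m). lpc_row x d) = 1 + real m * (x + 1 / x)"
  by (induction m) (auto simp: lpc_row_def algebra_simps)

lemma LPC_row_sum:
  assumes "odd n" "i < n"
  shows "(\<Sum>j<n. LPC x n $$ (i, j)) = 1 + (real n - 1) / 2 * (x + 1 / x)"
proof -
  have "(\<Sum>j<n. LPC x n $$ (i, j)) = (\<Sum>d<n. lpc_row x d)"
    using assms
    by (intro sum.reindex_bij_witness[where
          i = "\<lambda>d. if d < n - i then d + i else d + i - n" and
          j = "\<lambda>j. if i \<le> j then j - i else j + n - i"])
       (auto simp: LPC_circulant)
  moreover obtain m where "n = Suc (2 * m)"
    using \<open>odd n\<close> by (auto elim: oddE)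
  ultimately show ?thesis
    using sum_lpc_row[of x m] by simp
qed

theorem mainTheorem1:
  fixes x :: real and n :: nat
  assumes "x > 0" and "x \<noteq> 1" and "n \<ge> 3" and "odd n"
  shows "perron_root (LPC x n) = 1 + (real n - 1) / 2 * (x + 1 / x)
    \<and> eigenvector (LPC x n) (vec n (\<lambda>_. 1)) (perron_root (LPC x n))
    \<and> consistency_index (LPC x n) = (x - 1)\<^sup>2 / (2 * x)"
proof -
  have carrier: "LPC x n \<in> carrier_mat n n"
    by (simp add: LPC_def)
  have "n > 0"
    using \<open>n \<ge> 3\<close> by simp
  have nonneg: "LPC x n $$ (i, j) \<ge> 0" if "i < n" "j < n" for i j
    using \<open>x > 0\<close> that by (simp add: LPC_def lpc_upper_def)
  note rows = LPC_row_sum[OF \<open>odd n\<close>]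
  have root: "perron_root (LPC x n) = 1 + (real n - 1) / 2 * (x + 1 / x)"
    by (rule perron_root_constant_row_sum[OF carrier \<open>n > 0\<close> nonneg rows])
  moreover have "eigenvector (LPC x n) (vec n (\<lambda>_. 1)) (perron_root (LPC x n))"
    unfolding root by (rule eigenvector_ones_constant_row_sum[OF carrier \<open>n > 0\<close> rows])
  moreover have "consistency_index (LPC x n) = (x - 1)\<^sup>2 / (2 * x)"
  proof -
    have "consistency_index (LPC x n)
        = (1 + (real n - 1) / 2 * (x + 1 / x) - real n) / (real n - 1)"
      using carrier by (simp add: consistency_index_def root)
    also have "\<dots> = (x + 1 / x) / 2 - 1"
      using \<open>n \<ge> 3\<close> \<open>x > 0\<close> by (simp add: field_simps)
    also have "\<dots> = (x - 1)\<^sup>2 / (2 * x)"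
      using \<open>x > 0\<close> by (simp add: field_simps power2_eq_square)
    finally show ?thesis .
  qed
  ultimately show ?thesis
    by blast
qed

end
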